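(* Let $m>n$ be positive integers and let $\alpha=(\alpha_1,\dots,\alpha_L)$ be a composition of $n$. Let $$r=\mathrm{rr}(\alpha,m)=\min\left\{\mathrm{Iones}(\alpha)+1,\left\lceil\frac{n}{m-n}\right\rceil\right\}.$$ Then for all non-negative integers $a\le b$, $$\left|\mathcal{D}_{m,\alpha}^{(r+a,\,r+b-a)}\right|=\left|\mathcal{D}_{m,\alpha}^{(r+b,\,r)}\right|.$$
   Context: An $m\times n$ rational Dyck path is a lattice path from $(0,0)$ to $(m,n)$ using unit north steps $N$ and east steps $E$ that stays weakly above the line $y=nx/m$; $\mathcal{D}_{m,n}$ is the set of these paths. For $P\in\mathcal{D}_{m,n}$, let $(u_1,\dots,u_n)$ be its coarea sequence, where $u_i$ is the $x$-coordinate of the $i$-th north step of $P$ (bottom to top). Define $\mathrm{run}(P)=\min\{i\in\{1,\dots,n\}: i\notin\{u_1,\dots,u_n\}\}$. Let $\mathrm{ret}(P)$ be the number of north steps of $P$ from some $(i,j)$ to $(i,j+1)$ with $jm-in<n$. The composition type $\mathrm{comp}(P)$ is the composition of $n$ given by the lengths of the maximal blocks of consecutive north steps of $P$, in order. For a composition $\alpha$ of $n$, $\mathcal{D}_{m,\alpha}=\{P\in\mathcal{D}_{m,n}:\mathrm{comp}(P)=\alpha\}$ and $\mathcal{D}_{m,\alpha}^{(k,\ell)}=\{P\in\mathcal{D}_{m,\alpha}:\mathrm{run}(P)=k,\ \mathrm{ret}(P)=\ell\}$. $\mathrm{Iones}(\alpha)$ is the largest $j\ge 0$ such that $\alpha_1=\dots=\alpha_j=1$.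 *)

theory Defs
  imports Complex_Main
begin

datatype step = North | East

text \<open>
  A lattice path starting at the origin is the list of its steps; the coordinates below
  are those of the lattice point reached after the first \<open>k\<close> steps.
\<close>

definition xcoord :: "step list \<Rightarrow> nat \<Rightarrow> nat" where
  "xcoord P k = count_list (take k P) East"

definition ycoord :: "step list \<Rightarrow> nat \<Rightarrow> nat" where
  "ycoord P k = count_list (take k P) North"

text \<open>
  The condition of staying weakly above the line \<open>y = n x / m\<close> is imposed at the lattice
  points of the path, which suffices since steps are straight segments; it is multiplied
  by \<open>m\<close> to stay within the naturals.
\<close>

definition dyck_paths :: "nat \<Rightarrow> nat \<Rightarrow> step list set" where
  "dyck_paths m n = {P. count_list P East = m \<and> count_list P North = n \<and>
     (\<forall>k\<le>length P. n * xcoord P k \<le> m * ycoord P k)}"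

definition north_steps :: "step list \<Rightarrow> nat list" where
  "north_steps P = filter (\<lambda>k. P ! k = North) [0..<length P]"

definition coarea_seq :: "step list \<Rightarrow> nat list" where
  "coarea_seq P = map (xcoord P) (north_steps P)"

text \<open>
  On Dyck paths with \<open>n \<ge> 1\<close> the first coarea entry is \<open>0\<close>, so the set below is nonempty.
\<close>

definition run :: "nat \<Rightarrow> step list \<Rightarrow> nat" where
  "run n P = Min {i \<in> {1..n}. i \<notin> set (coarea_seq P)}"

definition ret :: "nat \<Rightarrow> nat \<Rightarrow> step list \<Rightarrow> nat" where
  "ret m n P = card {k \<in> set (north_steps P).
     int (ycoord P k) * int m - int (xcoord P k) * int n < int n}"

declare length_dropWhile_le [termination_simp]

fun comp_type :: "step list \<Rightarrow> nat list" where
  "comp_type [] = []"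
| "comp_type (East # P) = comp_type P"
| "comp_type (North # P) =
     Suc (length (takeWhile (\<lambda>s. s = North) P)) # comp_type (dropWhile (\<lambda>s. s = North) P)"

definition composition :: "nat \<Rightarrow> nat list \<Rightarrow> bool" where
  "composition n \<alpha> \<longleftrightarrow> (\<forall>x\<in>set \<alpha>. 0 < x) \<and> sum_list \<alpha> = n"

definition dyck_paths_comp :: "nat \<Rightarrow> nat \<Rightarrow> nat list \<Rightarrow> step list set" where
  "dyck_paths_comp m n \<alpha> = {P \<in> dyck_paths m n. comp_type P = \<alpha>}"

definition dyck_paths_run_ret :: "nat \<Rightarrow> nat \<Rightarrow> nat list \<Rightarrow> nat \<Rightarrow> nat \<Rightarrow> step list set" where
  "dyck_paths_run_ret m n \<alpha> k l = {P \<in> dyck_paths_comp m n \<alpha>. run n P = k \<and> ret m n P = l}"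

definition Iones :: "nat list \<Rightarrow> nat" where
  "Iones \<alpha> = Max {j. j \<le> length \<alpha> \<and> (\<forall>i<j. \<alpha> ! i = 1)}"

definition rr :: "nat \<Rightarrow> nat list \<Rightarrow> nat \<Rightarrow> nat" where
  "rr n \<alpha> m = min (Iones \<alpha> + 1) (nat \<lceil>real n / (real m - real n)\<rceil>)"

text \<open>Cardinalities of sets of paths are genuine, since these sets are finite.\<close>

lemma finite_dyck_paths: "finite (dyck_paths m n)"
proof -
  have UN: "(UNIV :: step set) = {North, East}"
    by (auto intro: step.exhaust)
  have len: "length P = count_list P East + count_list P North" for P :: "step list"
  proof (induction P)
    case (Cons s P)
    then show ?case by (cases s) auto
  qed simp
  have "dyck_paths m n \<subseteq> {P. set P \<subseteq> {North, East} \<and> length P = m + n}"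
    using len UN by (auto simp: dyck_paths_def)
  moreover have "finite {P. set P \<subseteq> {North, East} \<and> length P = m + n}"
    by (intro finite_lists_length_eq) auto
  ultimately show ?thesis
    by (rule finite_subset)
qed

end

theory Submission
  imports Defs
begin

text \<open>
  A path of composition type \<open>\<alpha>\<close> is determined by the \<open>x\<close>-coordinates
  \<open>v\<^sub>0 < v\<^sub>1 < \<dots>\<close> of its blocks of north steps. Put \<open>w\<^sub>i = v\<^sub>i - i\<close>: these are exactly the weakly
  increasing sequences with \<open>w\<^sub>i \<le> d\<^sub>i\<close>, where \<open>d\<^sub>i = \<lfloor>(\<alpha>\<^sub>1 + \<dots> + \<alpha>\<^sub>i) m / n\<rfloor> - i\<close> is itself weakly
  increasing because \<open>m > n\<close>. Then \<open>run\<close> is the number of zeros of \<open>w\<close>, \<open>ret\<close> is the number of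
  contacts \<open>w\<^sub>i = d\<^sub>i\<close>, and \<open>rr\<close> is the number of zeros of \<open>d\<close>. These first \<open>rr\<close> positions are
  forced and contribute to both statistics, so assume that \<open>d\<close> is positive. Deleting one zero
  of \<open>w\<close>, shifting the following entries to the left, and inserting \<open>d\<^sub>j\<close> at the first position
  \<open>j\<close> at which this keeps the sequence sorted trades one zero for one contact. The inverse
  deletes the first contact and prepends a zero. Hence the count only depends on the sum
  of the two statistics.
\<close>

section \<open>Sequences below a boundary\<close>

definition contacts :: "nat list \<Rightarrow> nat list \<Rightarrow> nat" where
  "contacts ds ws = length (filter (\<lambda>(d, w). w = d) (zip ds ws))"

lemma contacts_simps [simp]:
  "contacts [] ws = 0" "contacts ds [] = 0"
  "contacts (d # ds) (w # ws) = (if w = d then 1 else 0) + contacts ds ws"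
  by (auto simp: contacts_def)

definition below :: "nat list \<Rightarrow> nat \<Rightarrow> nat \<Rightarrow> nat list set" where
  "below ds z c =
    {ws. sorted ws \<and> list_all2 (\<le>) ws ds \<and> count_list ws 0 = z \<and> contacts ds ws = c}"

fun insert_contact :: "nat list \<Rightarrow> nat list \<Rightarrow> nat list" where
  "insert_contact [] ws = ws"
| "insert_contact (d # ds) [] = [d]"
| "insert_contact (d # ds) (w # ws) =
    (if d \<le> w then d # w # ws else w # insert_contact ds ws)"

fun delete_contact :: "nat list \<Rightarrow> nat list \<Rightarrow> nat list" where
  "delete_contact (d # ds) (w # ws) = (if w = d then ws else w # delete_contact ds ws)"
| "delete_contact _ ws = ws"

text \<open>Insertion passes only entries strictly below their bounds, so the inserted bound is the
  first contact. The extra bound in \<open>ds\<close> guarantees that an insertion takes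
  place.\<close>

lemma delete_insert_contact:
  "length ds = Suc (length ws) \<Longrightarrow> delete_contact ds (insert_contact ds ws) = ws"
  by (induction ds ws rule: insert_contact.induct) auto

text \<open>Entries before the first contact are strictly below their bounds, so insertion cannot
  stop earlier. At the deleted position it does stop, since by sortedness the next entry, if any, is
  at least the deleted one.\<close>

lemma insert_delete_contact:
  "sorted ws \<Longrightarrow> list_all2 (\<le>) ws ds \<Longrightarrow> 0 < contacts ds ws \<Longrightarrow>
    insert_contact ds (delete_contact ds ws) = ws"
proof (induction ds ws rule: delete_contact.induct)
  case (1 d ds w ws)
  then show ?case by (cases ws) auto
qed auto

lemma set_insert_contact: "set (insert_contact ds ws) \<subseteq> set ds \<union> set ws"
  by (induction ds ws rule: insert_contact.induct) auto

lemma set_delete_contact: "set (delete_contact ds ws) \<subseteq> set ws"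
  by (induction ds ws rule: delete_contact.induct) auto

lemma sorted_insert_contact:
  "sorted ds \<Longrightarrow> sorted ws \<Longrightarrow> sorted (insert_contact ds ws)"
proof (induction ds ws rule: insert_contact.induct)
  case (3 d ds w ws)
  then show ?case
    using set_insert_contact[of ds ws] by (fastforce simp: not_le)
qed auto

lemma sorted_delete_contact: "sorted ws \<Longrightarrow> sorted (delete_contact ds ws)"
proof (induction ds ws rule: delete_contact.induct)
  case (1 d ds w ws)
  then show ?case using set_delete_contact[of ds ws] by auto
qed auto

text \<open>Entries before the insertion point satisfy \<open>w < d\<close> by the test that was
  passed; entries after it move one place to the right, back under the bound they had in
  \<open>tl ds\<close>.\<close>

lemma list_all2_insert_contact:
  "list_all2 (\<le>) ws (tl ds) \<Longrightarrow> ds \<noteq> [] \<Longrightarrow> list_all2 (\<le>) (insert_contact ds ws) ds"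
proof (induction ds ws rule: insert_contact.induct)
  case (3 d ds w ws)
  then show ?case by (cases ds) auto
qed auto

text \<open>Entries before the deleted one are now compared with the next, larger bound; those after
  it move left and keep their own.\<close>

lemma list_all2_delete_contact:
  "sorted ds \<Longrightarrow> list_all2 (\<le>) ws ds \<Longrightarrow> 0 < contacts ds ws \<Longrightarrow>
    list_all2 (\<le>) (delete_contact ds ws) (tl ds)"
proof (induction ds ws rule: delete_contact.induct)
  case (1 d ds w ws)
  then show ?case by (cases ds) (auto split: if_splits)
qed auto

text \<open>Before the insertion point \<open>w < d\<close>, and the next bound is at least
  \<open>d\<close>, so neither alignment has a contact there. After it the two alignments agree, and
  the inserted bound is the one new contact.\<close>

lemma contacts_insert_contact:
  "sorted ds \<Longrightarrow> length ds = Suc (length ws) \<Longrightarrow>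
    contacts ds (insert_contact ds ws) = Suc (contacts (tl ds) ws)"
proof (induction ds ws rule: insert_contact.induct)
  case (3 d ds w ws)
  then show ?case by (cases ds) auto
qed auto

lemma count_zero_insert_contact:
  "0 \<notin> set ds \<Longrightarrow> length ds = Suc (length ws) \<Longrightarrow>
    count_list (insert_contact ds ws) 0 = count_list ws 0"
  by (induction ds ws rule: insert_contact.induct) auto

text \<open>Removing the leading zero aligns the other entries with \<open>tl ds\<close>, as
  insertion expects. As all bounds are positive, that zero was no contact and the inserted contact
  is no zero.\<close>

lemma card_below_Suc:
  assumes "sorted ds" "0 \<notin> set ds"
  shows "card (below ds (Suc z) c) = card (below ds z (Suc c))"
proof (rule bij_betw_same_card)
  show "bij_betw (\<lambda>ws. insert_contact ds (tl ws)) (below ds (Suc z) c) (below ds z (Suc c))"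
  proof (rule bij_betw_byWitness[where f' = "\<lambda>ws. 0 # delete_contact ds ws"])
    have shape: "\<exists>us e es. ws = 0 # us \<and> ds = e # es \<and> length es = length us"
      if ws: "ws \<in> below ds (Suc z) c" for ws
    proof -
      obtain w us where w: "ws = w # us"
        using ws by (cases ws) (auto simp: below_def)
      have "0 \<in> set ws"
        using ws count_list_0_iff[of ws 0] by (auto simp: below_def)
      then have "w = 0"
        using ws w by (auto simp: below_def)
      then show ?thesis
        using ws w by (auto simp: below_def list_all2_Cons1 dest: list_all2_lengthD)
    qed
    show "\<forall>ws\<in>below ds (Suc z) c. 0 # delete_contact ds (insert_contact ds (tl ws)) = ws"
      using shape by (fastforce simp: delete_insert_contact)
    show "\<forall>ws\<in>below ds z (Suc c). insert_contact ds (tl (0 # delete_contact ds ws)) = ws"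
      by (auto simp: below_def insert_delete_contact)
    show "(\<lambda>ws. insert_contact ds (tl ws)) ` below ds (Suc z) c \<subseteq> below ds z (Suc c)"
    proof safe
      fix ws assume ws: "ws \<in> below ds (Suc z) c"
      then obtain us e es where "ws = 0 # us" "ds = e # es" "length es = length us"
        using shape by blast
      then show "insert_contact ds (tl ws) \<in> below ds z (Suc c)"
        using ws assms sorted_insert_contact[of ds us] list_all2_insert_contact[of us ds]
          contacts_insert_contact[of ds us] count_zero_insert_contact[of ds us]
        by (auto simp: below_def)
    qed
    show "(\<lambda>ws. 0 # delete_contact ds ws) ` below ds z (Suc c) \<subseteq> below ds (Suc z) c"
    proof safe
      fix ws assume ws: "ws \<in> below ds z (Suc c)"
      define us where "us = delete_contact ds ws"
      obtain e es where ds: "ds = e # es"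
        using ws by (cases ds) (auto simp: below_def)
      have us: "list_all2 (\<le>) us es" "sorted us" "insert_contact ds us = ws"
        using ws assms ds list_all2_delete_contact[of ds ws]
        by (auto simp: below_def us_def sorted_delete_contact insert_delete_contact)
      have "length ds = Suc (length us)"
        using us(1) ds by (auto dest: list_all2_lengthD)
      \<comment> \<open>Both statistics of \<open>us\<close> follow from those of
        \<open>ws = insert_contact ds us\<close>, so counting under deletion reduces to counting
        under insertion.\<close>
      then have "count_list us 0 = z" "contacts es us = c"
        using ws us(3) ds assms contacts_insert_contact[of ds us] count_zero_insert_contact[of ds us]
        by (auto simp: below_def)
      then show "0 # delete_contact ds ws \<in> below ds (Suc z) c"
        unfolding us_def[symmetric] using us(1,2) ds assms(2) by (auto simp: below_def)
    qed
  qed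
qed

lemma card_below_add:
  assumes "sorted ds" "0 \<notin> set ds"
  shows "card (below ds z (c + k)) = card (below ds (z + k) c)"
  using card_below_Suc[OF assms] by (induction k arbitrary: c) (simp, metis add_Suc_right add_Suc)

text \<open>A bound 0 forces the first entry to be 0, which counts both as a zero and as a
  contact.\<close>

lemma below_Cons_zero: "below (0 # ds) (Suc z) (Suc c) = (#) 0 ` below ds z c"
  by (auto simp: below_def list_all2_Cons2 image_iff)

lemma card_below_replicate_zero:
  "card (below (replicate r 0 @ ds) (r + z) (r + c)) = card (below ds z c)"
  by (induction r) (simp_all add: below_Cons_zero card_image)

section \<open>Paths from block positions\<close>

text \<open>Here \<open>x\<close> is the current abscissa, and the last clause runs east to
  \<open>m\<close>. The truncated differences are exact when \<open>vs\<close> increases, starts at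
  \<open>x\<close> or later and stays at most \<open>m\<close>.\<close>

fun build :: "nat \<Rightarrow> nat \<Rightarrow> nat list \<Rightarrow> nat list \<Rightarrow> step list" where
  "build m x (v # vs) (a # as) =
    replicate (v - x) East @ replicate a North @ build m v vs as"
| "build m x _ _ = replicate (m - x) East"

fun starts :: "nat \<Rightarrow> step list \<Rightarrow> nat list" where
  "starts x [] = []"
| "starts x (East # P) = starts (Suc x) P"
| "starts x (North # P) = x # starts x (dropWhile (\<lambda>s. s = North) P)"

section \<open>Path statistics in terms of the starting points of north steps\<close>

fun norths :: "nat \<Rightarrow> nat \<Rightarrow> step list \<Rightarrow> (nat \<times> nat) list" where
  "norths x y [] = []"
| "norths x y (East # P) = norths (Suc x) y P"
| "norths x y (North # P) = (x, y) # norths x (Suc y) P"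

lemma xcoord_Cons: "xcoord (s # P) (Suc k) = (if s = East then 1 else 0) + xcoord P k"
  and ycoord_Cons: "ycoord (s # P) (Suc k) = (if s = North then 1 else 0) + ycoord P k"
  and coord_0 [simp]: "xcoord P 0 = 0" "ycoord P 0 = 0"
  by (auto simp: xcoord_def ycoord_def)

lemma north_steps_Cons:
  "north_steps (s # P) = (if s = North then [0] else []) @ map Suc (north_steps P)"
proof -
  have "[0..<length (s # P)] = 0 # map Suc [0..<length P]"
    by (simp add: upt_conv_Cons map_Suc_upt del: upt_Suc)
  then show ?thesis
    by (simp add: north_steps_def filter_map o_def)
qed

lemma norths_eq:
  "norths x y P = map (\<lambda>k. (x + xcoord P k, y + ycoord P k)) (north_steps P)"
proof (induction x y P rule: norths.induct)
  case 1
  then show ?case by (simp add: north_steps_def)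
qed (auto simp: north_steps_Cons xcoord_Cons ycoord_Cons)

lemma coarea_seq_norths: "coarea_seq P = map fst (norths 0 0 P)"
  by (simp add: coarea_seq_def norths_eq o_def)

lemma ret_norths:
  "ret m n P = length (filter (\<lambda>(x, y). int y * int m - int x * int n < int n) (norths 0 0 P))"
proof -
  have "distinct (north_steps P)"
    by (simp add: north_steps_def)
  then show ?thesis
    by (simp add: ret_def norths_eq filter_map o_def distinct_length_filter Int_def conj_commute)
qed

lemma all_le_length_Cons:
  "(\<forall>k\<le>length (s # P). Q k) \<longleftrightarrow> Q 0 \<and> (\<forall>k\<le>length P. Q (Suc k))"
  by (simp add: All_less_Suc2 less_Suc_eq_le[symmetric])

text \<open>Along a run of east steps the condition is tightest at its right end, which is the start
  of a north step or the end of the path.\<close>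

lemma above_line_norths:
  fixes m n :: nat
  shows "(\<forall>k\<le>length P. n * (x + xcoord P k) \<le> m * (y + ycoord P k)) \<longleftrightarrow>
    n * (x + count_list P East) \<le> m * (y + count_list P North) \<and>
    (\<forall>(x, y)\<in>set (norths x y P). n * x \<le> m * y)"
proof (induction x y P rule: norths.induct)
  case (2 x y P)
  \<comment> \<open>The condition before an east step follows from the one after it, which is index
    0 of the remaining path.\<close>
  have "n * x \<le> m * y" if "n * (Suc x + xcoord P 0) \<le> m * (y + ycoord P 0)"
    using that by simp
  then show ?case
    using 2 unfolding all_le_length_Cons xcoord_Cons ycoord_Cons by auto
next
  case (3 x y P)
  then show ?case
    unfolding all_le_length_Cons xcoord_Cons ycoord_Cons by auto
qed simp

lemma dyck_paths_norths:
  "P \<in> dyck_paths m n \<longleftrightarrow> count_list P East = m \<and> count_list P North = n \<and>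
    (\<forall>(x, y)\<in>set (norths 0 0 P). n * x \<le> m * y)"
  using above_line_norths[of P n 0 m 0] by (auto simp: dyck_paths_def)

section \<open>Correspondence between paths and their block data\<close>

lemma comp_type_East [simp]: "comp_type (replicate k East @ P) = comp_type P"
  by (induction k) auto

lemma starts_East [simp]: "starts x (replicate k East @ P) = starts (x + k) P"
  by (induction k arbitrary: x) auto

lemma norths_East [simp]: "norths x y (replicate k East @ P) = norths (x + k) y P"
  by (induction k arbitrary: x) auto

lemma norths_North [simp]:
  "norths x y (replicate k North @ P) = map (Pair x) [y..<y + k] @ norths x (y + k) P"
  by (induction k arbitrary: y) (auto simp: upt_conv_Cons simp del: upt_Suc)

lemma takeWhile_eq_replicate:
  "takeWhile (\<lambda>y. y = x) xs = replicate (length (takeWhile (\<lambda>y. y = x) xs)) x"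
  by (induction xs) auto

text \<open>What follows a block is empty or begins with an east step; hence consecutive blocks do
  not merge and each is maximal.\<close>

lemma takeWhile_build:
  assumes "\<forall>v\<in>set vs. x < v" "\<forall>a\<in>set as. 0 < a"
  shows "takeWhile (\<lambda>s. s = North) (build m x vs as) = [] \<and>
    dropWhile (\<lambda>s. s = North) (build m x vs as) = build m x vs as"
proof -
  have *: "takeWhile (\<lambda>s. s = North) (replicate k East @ Q) = [] \<and>
      dropWhile (\<lambda>s. s = North) (replicate k East @ Q) = replicate k East @ Q"
    if "0 < k \<or> Q = []" for k Q
    using that by (cases k) auto
  show ?thesis
    using assms *[of "m - x" "[]"]
    by (cases "(m, x, vs, as)" rule: build.cases) (auto intro!: * simp: *)
qed

lemma comp_type_build:
  "length vs = length as \<Longrightarrow> sorted_wrt (<) vs \<Longrightarrow> \<forall>a\<in>set as. 0 < a \<Longrightarrow>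
    comp_type (build m x vs as) = as"
proof (induction m x vs as rule: build.induct)
  case (1 m x v vs a as)
  then obtain a' where "a = Suc a'"
    by (cases a) auto
  then show ?case
    using 1 takeWhile_build[of vs v as m]
    by (simp add: takeWhile_append dropWhile_append)
qed (use comp_type_East[of _ "[]"] in auto)

lemma starts_build:
  "length vs = length as \<Longrightarrow> sorted_wrt (<) vs \<Longrightarrow> \<forall>a\<in>set as. 0 < a \<Longrightarrow> \<forall>v\<in>set vs. x \<le> v \<Longrightarrow>
    starts x (build m x vs as) = vs"
proof (induction m x vs as rule: build.induct)
  case (1 m x v vs a as)
  then obtain a' where "a = Suc a'"
    by (cases a) auto
  then show ?case
    using 1 takeWhile_build[of vs v as m]
    by (auto simp: takeWhile_append dropWhile_append less_imp_le)
qed (use starts_East[of _ _ "[]"] in auto)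

lemma count_list_replicate: "count_list (replicate k s) t = (if s = t then k else 0)"
  by (induction k) auto

lemma count_build:
  "length vs = length as \<Longrightarrow> sorted_wrt (<) vs \<Longrightarrow> \<forall>v\<in>set vs. x \<le> v \<and> v \<le> m \<Longrightarrow> x \<le> m \<Longrightarrow>
    count_list (build m x vs as) East = m - x \<and> count_list (build m x vs as) North = sum_list as"
  by (induction m x vs as rule: build.induct) (auto simp: count_list_replicate less_imp_le)

lemma starts_ge: "v \<in> set (starts x P) \<Longrightarrow> x \<le> v"
proof (induction x P rule: starts.induct)
  case (2 x P)
  then show ?case by fastforce
qed auto

text \<open>Once the current block is dropped, an east step precedes every later block. This gives
  the strictness in \<open>sorted_starts\<close>.\<close>

lemma starts_dropWhile_gt: "v \<in> set (starts x (dropWhile (\<lambda>s. s = North) P)) \<Longrightarrow> x < v"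
proof (induction P)
  case (Cons s P)
  then show ?case by (cases s) (auto dest: starts_ge)
qed auto

lemma sorted_starts: "sorted_wrt (<) (starts x P)"
  by (induction x P rule: starts.induct) (auto dest: starts_dropWhile_gt)

lemma length_starts: "length (starts x P) = length (comp_type P)"
  by (induction x P rule: starts.induct) auto

lemma build_starts:
  "x + count_list P East = m \<Longrightarrow> build m x (starts x P) (comp_type P) = P"
proof (induction x P rule: starts.induct)
  case (2 x P)
  \<comment> \<open>The first east run, towards the first block or towards \<open>m\<close>, has
    positive length, so one step can be split off it.\<close>
  have "build m x vs as = East # build m (Suc x) vs as"
    if "\<forall>v\<in>set vs. Suc x \<le> v" "Suc x \<le> m" for vs as
  proof -
    have "replicate (k - x) East = East # replicate (k - Suc x) East" if "Suc x \<le> k" for k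
      using that by (metis Suc_diff_le diff_Suc_Suc replicate_Suc)
    then show ?thesis
      using that by (cases "(m, x, vs, as)" rule: build.cases) auto
  qed
  moreover have "\<forall>v\<in>set (starts (Suc x) P). Suc x \<le> v"
    by (blast dest: starts_ge)
  ultimately show ?case
    using 2 by simp
next
  case (3 x P)
  let ?t = "takeWhile (\<lambda>s. s = North) P" and ?d = "dropWhile (\<lambda>s. s = North) P"
  have t: "?t = replicate (length ?t) North"
    by (rule takeWhile_eq_replicate)
  have "count_list P East = count_list ?t East + count_list ?d East"
    by (metis count_list_append takeWhile_dropWhile_id)
  also have "count_list ?t East = 0"
    by (subst t) (simp add: count_list_replicate)
  finally have "build m x (starts x ?d) (comp_type ?d) = ?d"
    using 3 by simp
  then show ?case
    by (simp add: t[symmetric])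
qed simp

section \<open>Bounds on block positions, given by the height \<open>y\<close> at which a block
  starts\<close>

fun bounds :: "nat \<Rightarrow> nat \<Rightarrow> nat \<Rightarrow> nat list \<Rightarrow> nat list" where
  "bounds m n y [] = []"
| "bounds m n y (a # as) = y * m div n # bounds m n (y + a) as"

lemma norths_replicate_East [simp]: "norths x y (replicate k East) = []"
  using norths_East[of x y k "[]"] by simp

text \<open>All north steps of a block share its abscissa, so the coarea entries, on which
  \<open>run\<close> depends, are the block positions.\<close>

lemma set_norths_build:
  "length vs = length as \<Longrightarrow> sorted_wrt (<) vs \<Longrightarrow> \<forall>a\<in>set as. 0 < a \<Longrightarrow> \<forall>v\<in>set vs. x \<le> v \<Longrightarrow>
    fst ` set (norths x y (build m x vs as)) = set vs"
proof (induction m x vs as arbitrary: y rule: build.induct)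
  case (1 m x v vs a as)
  then have "fst ` set (norths v (y + a) (build m v vs as)) = set vs"
    by (simp add: less_imp_le)
  then show ?case
    using "1.prems" by (auto simp: image_Un image_image image_constant_conv)
qed auto

text \<open>Within a block the lowest north step is the most restrictive. The parameter
  \<open>M\<close> affects only the final east run, which contains no north step.\<close>

lemma above_line_build:
  assumes "0 < n"
  shows "length vs = length as \<Longrightarrow> sorted_wrt (<) vs \<Longrightarrow> \<forall>a\<in>set as. 0 < a \<Longrightarrow> \<forall>v\<in>set vs. x \<le> v \<Longrightarrow>
    (\<forall>(x, y)\<in>set (norths x y (build M x vs as)). n * x \<le> m * y) \<longleftrightarrow>
    list_all2 (\<le>) vs (bounds m n y as)"
proof (induction M x vs as arbitrary: y rule: build.induct)
  case (1 M x v vs a as)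
  have "(\<forall>j\<in>{y..<y + a}. n * v \<le> m * j) \<longleftrightarrow> n * v \<le> m * y"
  proof
    assume "n * v \<le> m * y"
    then show "\<forall>j\<in>{y..<y + a}. n * v \<le> m * j"
      by (meson atLeastLessThan_iff le_trans mult_le_mono2)
  qed (use 1 in auto)
  then have "(\<forall>j\<in>{y..<y + a}. n * v \<le> m * j) \<longleftrightarrow> v \<le> y * m div n"
    using assms by (simp add: less_eq_div_iff_mult_less_eq mult.commute)
  moreover have "\<forall>u\<in>set vs. v \<le> u"
    using 1 by auto
  moreover note "1.IH"[of "y + a"]
  ultimately show ?case
    using 1 by (simp add: ball_Un)
qed auto

text \<open>Along a block \<open>y * m - x * n\<close> starts nonnegative and grows by
  \<open>m > n\<close> per step, so only the lowest north step can count. It counts exactly if the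
  block cannot start one unit further right, that is, if it meets its bound.\<close>

lemma ret_build:
  assumes "0 < n" "n < m"
  shows "length vs = length as \<Longrightarrow> sorted_wrt (<) vs \<Longrightarrow> \<forall>a\<in>set as. 0 < a \<Longrightarrow> \<forall>v\<in>set vs. x \<le> v \<Longrightarrow>
    list_all2 (\<le>) vs (bounds m n y as) \<Longrightarrow>
    length (filter (\<lambda>(x, y). int y * int m - int x * int n < int n) (norths x y (build M x vs as))) =
    contacts (bounds m n y as) vs"
proof (induction M x vs as arbitrary: y rule: build.induct)
  case (1 M x v vs a as)
  let ?Q = "\<lambda>y. int y * int m - int v * int n < int n"
  obtain a' where a: "a = Suc a'"
    using 1 by (cases a) auto
  have v: "v * n \<le> y * m"
    using 1 assms by (simp add: less_eq_div_iff_mult_less_eq)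
  have first: "?Q y \<longleftrightarrow> v = y * m div n"
  proof -
    have "?Q y \<longleftrightarrow> y * m < Suc v * n"
      using of_nat_less_iff[of "y * m" "Suc v * n", where 'a = int] by (simp add: algebra_simps)
    also have "\<dots> \<longleftrightarrow> y * m div n < Suc v"
      using assms by (simp add: div_less_iff_less_mult)
    finally show ?thesis
      using 1 by auto
  qed
  have "\<not> ?Q j" if "Suc y \<le> j" for j
  proof -
    have "n + v * n \<le> m + y * m"
      using v assms by simp
    also have "\<dots> \<le> j * m"
      using mult_le_mono1[OF that, of m] by simp
    finally have "int (n + v * n) \<le> int (j * m)"
      by (simp only: of_nat_le_iff)
    then show ?thesis by simp
  qed
  then have rest: "filter ?Q [Suc y..<y + a] = []"
    by (simp add: filter_empty_conv)
  have "[y..<y + a] = y # [Suc y..<y + a]"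
    using a by (simp add: upt_conv_Cons del: upt_Suc)
  then have "filter ?Q [y..<y + a] = (if v = y * m div n then [y] else [])"
    by (simp only: filter.simps rest first)
  then have "length (filter ?Q [y..<y + a]) = (if v = y * m div n then 1 else 0)"
    by simp
  moreover have "length (filter (\<lambda>(x, y). int y * int m - int x * int n < int n)
      (norths v (y + a) (build M v vs as))) = contacts (bounds m n (y + a) as) vs"
    using "1.prems" by (intro "1.IH") auto
  ultimately show ?case
    using "1.prems" by (simp add: filter_map o_def)
qed auto

section \<open>Removing the forced increments\<close>

fun shift :: "nat \<Rightarrow> nat list \<Rightarrow> nat list" where
  "shift k [] = []"
| "shift k (w # ws) = (w + k) # shift (Suc k) ws"

fun unshift :: "nat \<Rightarrow> nat list \<Rightarrow> nat list" where
  "unshift k [] = []"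
| "unshift k (v # vs) = (v - k) # unshift (Suc k) vs"

lemma length_shift [simp]: "length (shift k ws) = length ws"
  by (induction ws arbitrary: k) auto

lemma length_unshift [simp]: "length (unshift k ws) = length ws"
  by (induction ws arbitrary: k) auto

lemma unshift_shift [simp]: "unshift k (shift k ws) = ws"
  by (induction ws arbitrary: k) auto

text \<open>Neighbouring offsets differ by 1, which turns weak into strict comparisons of
  neighbours.\<close>

lemma sorted_shift_iff: "sorted_wrt (<) (shift k ws) \<longleftrightarrow> sorted ws"
proof (induction ws arbitrary: k)
  case (Cons w ws)
  have *: "sorted_wrt (<) (u # us) \<longleftrightarrow> (us = [] \<or> u < hd us) \<and> sorted_wrt (<) us"
    "sorted (u # us) \<longleftrightarrow> (us = [] \<or> u \<le> hd us) \<and> sorted us" for u :: nat and us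
    by (cases us; force)+
  show ?case
    unfolding shift.simps * Cons by (cases ws) auto
qed simp

text \<open>Strict increase propagates \<open>k \<le> v\<close> to the growing offsets, so no
  subtraction is truncated.\<close>

lemma shift_unshift:
  "sorted_wrt (<) vs \<Longrightarrow> \<forall>v\<in>set vs. k \<le> v \<Longrightarrow> shift k (unshift k vs) = vs"
proof (induction vs arbitrary: k)
  case (Cons v vs)
  then show ?case by (auto intro!: Cons.IH)
qed simp

lemma bounds_ge:
  assumes "0 < n" "n < m"
  shows "\<forall>a\<in>set as. 0 < a \<Longrightarrow> c \<in> set (bounds m n y as) \<Longrightarrow> y * m div n \<le> c"
proof (induction as arbitrary: y)
  case (Cons a as)
  have "y * m div n \<le> (y + a) * m div n"
    by (intro div_le_mono mult_le_mono1) simp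
  then show ?case using Cons by fastforce
qed simp

text \<open>A block of \<open>a > 0\<close> north steps raises \<open>y * m\<close> by
  \<open>a * m \<ge> n\<close>, hence the quotient by at least 1.\<close>

lemma sorted_bounds:
  assumes "0 < n" "n < m"
  shows "\<forall>a\<in>set as. 0 < a \<Longrightarrow> sorted_wrt (<) (bounds m n y as)"
proof (induction as arbitrary: y)
  case (Cons a as)
  have "Suc (y * m div n) = (y * m + n) div n"
    using assms by simp
  also have "\<dots> \<le> (y + a) * m div n"
  proof (rule div_le_mono)
    have "1 * n \<le> a * m"
      using assms Cons.prems by (intro mult_le_mono) auto
    then show "y * m + n \<le> (y + a) * m"
      by (simp add: add_mult_distrib)
  qed
  finally show ?case
    using Cons bounds_ge[OF assms, of as _ "y + a"] by fastforce
qed simp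

lemma list_all2_shift_iff:
  assumes "sorted_wrt (<) cs" "\<forall>c\<in>set cs. k \<le> c"
  shows "list_all2 (\<le>) (shift k ws) cs \<longleftrightarrow> list_all2 (\<le>) ws (unshift k cs)"
  using assms
proof (induction cs arbitrary: k ws)
  case (Cons c cs)
  have "\<forall>c\<in>set cs. Suc k \<le> c"
    using Cons.prems by fastforce
  then show ?case
    using Cons by (cases ws) auto
next
  case Nil
  then show ?case by (cases ws) auto
qed

lemma contacts_shift:
  assumes "sorted_wrt (<) cs" "\<forall>c\<in>set cs. k \<le> c"
  shows "contacts cs (shift k ws) = contacts (unshift k cs) ws"
  using assms
proof (induction cs arbitrary: k ws)
  case (Cons c cs)
  have "\<forall>c\<in>set cs. Suc k \<le> c"
    using Cons.prems by fastforce
  then show ?case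
    using Cons by (cases ws) auto
qed auto

lemma set_shift_ge: "v \<in> set (shift k ws) \<Longrightarrow> k \<le> v"
proof (induction ws arbitrary: k)
  case (Cons w ws)
  show ?case
    using Cons.IH[of "Suc k"] Cons.prems by auto
qed simp

text \<open>With \<open>z\<close> zeros, these come first and become 0 to \<open>z - 1\<close>,
  while the later entries are positive and become larger than \<open>z\<close>. So \<open>z\<close>
  is the first missing value; the other hypotheses place it in \<open>{1..n}\<close>.\<close>

lemma Min_missing_shift:
  assumes "sorted ws" "hd ws = 0" "ws \<noteq> []" "length ws \<le> n"
  shows "Min {i \<in> {1..n}. i \<notin> set (shift 0 ws)} = count_list ws 0"
proof -
  have initial: "k + i \<in> set (shift k us)" if "sorted us" "i < count_list us 0" for k i us
    using that
  proof (induction us arbitrary: k i)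
    case (Cons u us)
    then have "u = 0"
      using count_list_0_iff[of us 0] by (cases "0 \<in> set us") (auto split: if_splits)
    then show ?case
      using Cons.IH[of "i - 1" "Suc k"] Cons.prems by (cases i) auto
  qed simp
  have missing: "k + count_list us 0 \<notin> set (shift k us)" if "sorted us" for k us
    using that
  proof (induction us arbitrary: k)
    case (Cons u us)
    show ?case
    proof (cases "u = 0")
      case True
      then show ?thesis
        using Cons.IH[of "Suc k"] Cons.prems by simp
    next
      case False
      then have "count_list us 0 = 0"
        using Cons.prems count_list_0_iff[of us 0] by auto
      then show ?thesis
        using False set_shift_ge[of k "Suc k" us] by auto
    qed
  qed simp
  have "count_list ws 0 \<le> n"
    using count_le_length[of ws 0] assms(4) by simp
  moreover have "0 < count_list ws 0"
    using assms(2,3) by (cases ws) auto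
  ultimately have "count_list ws 0 \<in> {i \<in> {1..n}. i \<notin> set (shift 0 ws)}"
    using missing[OF assms(1), of 0] by simp
  moreover have "count_list ws 0 \<le> i" if "i \<notin> set (shift 0 ws)" for i
    using initial[OF assms(1), of i 0] that by (cases "i < count_list ws 0") auto
  ultimately show ?thesis
    by (intro Min_eqI) auto
qed

section \<open>The boundary and its zeros\<close>

lemma length_bounds [simp]: "length (bounds m n y as) = length as"
  by (induction as arbitrary: y) auto

lemma nth_bounds: "i < length as \<Longrightarrow> bounds m n y as ! i = (y + sum_list (take i as)) * m div n"
  by (induction as arbitrary: y i) (auto simp: nth_Cons' take_Cons' add.assoc)

lemma nth_unshift: "i < length vs \<Longrightarrow> unshift k vs ! i = vs ! i - (k + i)"
  by (induction vs arbitrary: k i) (auto simp: nth_Cons')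

lemma bounds_le:
  assumes "0 < n" "y + sum_list as \<le> n" "c \<in> set (bounds m n y as)"
  shows "c \<le> m"
  using assms(2,3)
proof (induction as arbitrary: y)
  case (Cons a as)
  have "y * m div n \<le> n * m div n"
    using Cons.prems by (intro div_le_mono mult_le_mono1) simp
  also have "\<dots> = m"
    using assms(1) by simp
  finally show ?case
    using Cons.prems Cons.IH[of "y + a"] by auto
qed simp

definition boundary :: "nat \<Rightarrow> nat \<Rightarrow> nat list \<Rightarrow> nat list" where
  "boundary m n \<alpha> = unshift 0 (bounds m n 0 \<alpha>)"

lemma sorted_boundary:
  assumes "0 < n" "n < m" "\<forall>a\<in>set \<alpha>. 0 < a"
  shows "sorted (boundary m n \<alpha>)"
  using sorted_bounds[OF assms] shift_unshift[OF sorted_bounds[OF assms], of 0]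
  by (simp add: boundary_def sorted_shift_iff[of 0, symmetric])

lemma length_le_sum_list: "\<forall>x\<in>set xs. 0 < x \<Longrightarrow> length xs \<le> sum_list xs" for xs :: "nat list"
  by (induction xs) auto

lemma sum_list_eq_length_iff:
  "\<forall>x\<in>set xs. 0 < x \<Longrightarrow> sum_list xs = length xs \<longleftrightarrow> (\<forall>x\<in>set xs. x = 1)" for xs :: "nat list"
proof (induction xs)
  case (Cons x xs)
  then show ?case using length_le_sum_list[of xs] by auto
qed simp

lemma le_Iones_iff:
  assumes "i \<le> length \<alpha>"
  shows "i \<le> Iones \<alpha> \<longleftrightarrow> (\<forall>x\<in>set (take i \<alpha>). x = 1)"
proof -
  let ?J = "{j. j \<le> length \<alpha> \<and> (\<forall>i<j. \<alpha> ! i = 1)}"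
  have fin: "finite ?J"
    by (rule finite_subset[of _ "{..length \<alpha>}"]) auto
  moreover have "0 \<in> ?J"
    by simp
  ultimately have J: "Iones \<alpha> \<in> ?J"
    unfolding Iones_def by (metis (no_types, lifting) Max_in empty_iff)
  have "i \<le> Iones \<alpha> \<longleftrightarrow> i \<in> ?J"
  proof
    assume "i \<in> ?J"
    then show "i \<le> Iones \<alpha>"
      unfolding Iones_def by (rule Max_ge[OF fin])
  qed (use J assms in auto)
  also have "\<dots> \<longleftrightarrow> (\<forall>x\<in>set (take i \<alpha>). x = 1)"
    using assms by (simp add: all_set_conv_all_nth)
  finally show ?thesis .
qed

text \<open>For a natural number, being below the ceiling of a quotient means being below the
  quotient; clearing the denominator \<open>m - n\<close> leaves naturals.\<close>

lemma less_rr_iff: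
  assumes "n < m"
  shows "i < rr n \<alpha> m \<longleftrightarrow> i \<le> Iones \<alpha> \<and> i * m < (i + 1) * n"
proof -
  have "i < nat \<lceil>real n / (real m - real n)\<rceil> \<longleftrightarrow> real i < real n / (real m - real n)"
    by (simp add: zless_nat_eq_int_zless less_ceiling_iff)
  also have "\<dots> \<longleftrightarrow> real i * real m < (real i + 1) * real n"
    using assms by (simp add: pos_less_divide_eq algebra_simps)
  also have "\<dots> \<longleftrightarrow> real (i * m) < real ((i + 1) * n)"
    by (simp add: algebra_simps)
  also have "\<dots> \<longleftrightarrow> i * m < (i + 1) * n"
    by (simp only: of_nat_less_iff)
  finally show ?thesis
    by (auto simp: rr_def)
qed

text \<open>Let \<open>?s\<close> be the sum of the first \<open>i\<close> parts. If
  \<open>?s > i\<close> then \<open>?s * m \<ge> (i + 1) * n\<close>, so a zero forces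
  \<open>?s = i\<close>, meaning that these parts are all 1.\<close>

lemma boundary_zero_iff:
  assumes "0 < n" "n < m" "\<forall>a\<in>set \<alpha>. 0 < a" "i < length \<alpha>"
  shows "boundary m n \<alpha> ! i = 0 \<longleftrightarrow> i < rr n \<alpha> m"
proof -
  let ?s = "sum_list (take i \<alpha>)"
  have pos: "\<forall>a\<in>set (take i \<alpha>). 0 < a"
    using assms by (auto dest: in_set_takeD)
  have ge: "i \<le> ?s"
    using length_le_sum_list[OF pos] assms(4) by simp
  have eq: "?s = i \<longleftrightarrow> i \<le> Iones \<alpha>"
    using sum_list_eq_length_iff[OF pos] le_Iones_iff[of i \<alpha>] assms(4) by simp
  have "boundary m n \<alpha> ! i = 0 \<longleftrightarrow> ?s * m div n < Suc i"
    \<comment> \<open>Subtraction is truncated, so the difference vanishes exactly if the bound is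
      at most \<open>i\<close>.\<close>
    using assms(4) by (simp add: boundary_def nth_unshift nth_bounds less_Suc_eq_le)
  also have "\<dots> \<longleftrightarrow> ?s * m < (i + 1) * n"
    using assms(1) by (simp add: div_less_iff_less_mult)
  also have "\<dots> \<longleftrightarrow> ?s = i \<and> i * m < (i + 1) * n"
  proof -
    have "(i + 1) * n \<le> ?s * m" if "?s \<noteq> i"
      using that ge assms(2) by (intro mult_le_mono) auto
    then show ?thesis by fastforce
  qed
  finally show ?thesis
    using eq less_rr_iff[OF assms(2)] by simp
qed

text \<open>Otherwise all parts are 1, so \<open>n = length \<alpha>\<close>, and
  \<open>n * m < (n + 1) * n\<close> contradicts \<open>n < m\<close>.\<close>

lemma rr_le_length:
  assumes "0 < n" "n < m" "composition n \<alpha>"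
  shows "rr n \<alpha> m \<le> length \<alpha>"
proof (rule ccontr)
  assume "\<not> rr n \<alpha> m \<le> length \<alpha>"
  then have *: "length \<alpha> \<le> Iones \<alpha>" "length \<alpha> * m < (length \<alpha> + 1) * n"
    using less_rr_iff[OF assms(2)] by (auto simp: not_le)
  then have "n = length \<alpha>"
    using assms(3) le_Iones_iff[of "length \<alpha>" \<alpha>] sum_list_eq_length_iff[of \<alpha>]
    by (simp add: composition_def)
  moreover have "n * (n + 1) \<le> n * m"
    using assms(2) by (intro mult_le_mono2) simp
  ultimately show False
    using *(2) by (simp add: mult.commute)
qed

lemma sorted_nat_split_zeros:
  fixes ds :: "nat list"
  assumes "sorted ds"
  obtains es where "ds = replicate (count_list ds 0) 0 @ es" "0 \<notin> set es" "sorted es"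
  using assms
proof (induction ds arbitrary: thesis)
  case (Cons d ds)
  show ?case
  proof (cases "d = 0")
    case True
    then show ?thesis
      using Cons by auto
  next
    case False
    then have "0 \<notin> set (d # ds)"
      using Cons.prems by auto
    moreover from this have "count_list (d # ds) 0 = 0"
      by (metis count_list_0_iff)
    ultimately show ?thesis
      using Cons.prems by auto
  qed
qed simp

lemma boundary_split:
  assumes "0 < n" "n < m" "composition n \<alpha>"
  obtains es where "boundary m n \<alpha> = replicate (rr n \<alpha> m) 0 @ es" "0 \<notin> set es" "sorted es"
proof -
  let ?ds = "boundary m n \<alpha>"
  have pos: "\<forall>a\<in>set \<alpha>. 0 < a"
    using assms by (simp add: composition_def)
  have "count_list ?ds 0 = card {i. i < length \<alpha> \<and> ?ds ! i = 0}"
    by (simp add: count_list_eq_length_filter length_filter_conv_card boundary_def eq_commute[of 0])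
  also have "{i. i < length \<alpha> \<and> ?ds ! i = 0} = {..<rr n \<alpha> m}"
    using boundary_zero_iff[OF assms(1,2) pos] rr_le_length[OF assms] by auto
  finally have "count_list ?ds 0 = rr n \<alpha> m"
    by simp
  then show ?thesis
    using sorted_nat_split_zeros[OF sorted_boundary[OF assms(1,2) pos]] that by metis
qed

section \<open>Transfer of the count from sequences to paths\<close>

lemma bij_betw_build_dyck_paths_comp:
  assumes "0 < n" "n < m" "composition n \<alpha>"
  shows "bij_betw (\<lambda>ws. build m 0 (shift 0 ws) \<alpha>)
    {ws. sorted ws \<and> list_all2 (\<le>) ws (boundary m n \<alpha>)} (dyck_paths_comp m n \<alpha>)"
proof -
  have pos: "\<forall>a\<in>set \<alpha>. 0 < a" and sum: "sum_list \<alpha> = n"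
    using assms by (simp_all add: composition_def)
  have list_all2_iff: "list_all2 (\<le>) ws (boundary m n \<alpha>) \<longleftrightarrow>
      list_all2 (\<le>) (shift 0 ws) (bounds m n 0 \<alpha>)" for ws
    by (simp add: boundary_def list_all2_shift_iff sorted_bounds assms pos)
  have len: "length (shift 0 ws) = length \<alpha>" if "list_all2 (\<le>) ws (boundary m n \<alpha>)" for ws
    using list_all2_lengthD[OF that] by (simp add: boundary_def)
  show ?thesis
  proof (rule bij_betw_byWitness[where f' = "\<lambda>P. unshift 0 (starts 0 P)"])
    show "\<forall>ws\<in>{ws. sorted ws \<and> list_all2 (\<le>) ws (boundary m n \<alpha>)}.
        unshift 0 (starts 0 (build m 0 (shift 0 ws) \<alpha>)) = ws"
      using len pos by (auto simp: starts_build sorted_shift_iff)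
    show "\<forall>P\<in>dyck_paths_comp m n \<alpha>. build m 0 (shift 0 (unshift 0 (starts 0 P))) \<alpha> = P"
      by (auto simp: dyck_paths_comp_def dyck_paths_norths shift_unshift sorted_starts build_starts)
    show "(\<lambda>ws. build m 0 (shift 0 ws) \<alpha>) ` {ws. sorted ws \<and> list_all2 (\<le>) ws (boundary m n \<alpha>)}
        \<subseteq> dyck_paths_comp m n \<alpha>"
    proof safe
      fix ws assume ws: "sorted ws" "list_all2 (\<le>) ws (boundary m n \<alpha>)"
      let ?vs = "shift 0 ws"
      have vs: "length ?vs = length \<alpha>" "sorted_wrt (<) ?vs" "\<forall>v\<in>set ?vs. 0 \<le> v"
          "list_all2 (\<le>) ?vs (bounds m n 0 \<alpha>)"
        using ws len[of ws] by (simp_all add: sorted_shift_iff list_all2_iff)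
      have le: "\<forall>v\<in>set ?vs. 0 \<le> v \<and> v \<le> m"
      proof (intro ballI conjI)
        fix v assume "v \<in> set ?vs"
        then obtain c where "c \<in> set (bounds m n 0 \<alpha>)" "v \<le> c"
          using vs(4) by (metis in_set_conv_nth list_all2_conv_all_nth)
        then show "v \<le> m"
          using bounds_le[OF assms(1), of 0 \<alpha> c m] sum by simp
      qed simp
      show "build m 0 ?vs \<alpha> \<in> dyck_paths_comp m n \<alpha>"
        using count_build[OF vs(1,2) le] above_line_build[OF assms(1) vs(1,2) pos vs(3), of 0 m m]
          comp_type_build[OF vs(1,2) pos, of m 0] vs(4) sum
        by (simp add: dyck_paths_comp_def dyck_paths_norths)
    qed
    show "(\<lambda>P. unshift 0 (starts 0 P)) ` dyck_paths_comp m n \<alpha>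
        \<subseteq> {ws. sorted ws \<and> list_all2 (\<le>) ws (boundary m n \<alpha>)}"
    proof safe
      fix P assume P: "P \<in> dyck_paths_comp m n \<alpha>"
      let ?vs = "starts 0 P"
      have vs: "length ?vs = length \<alpha>" "sorted_wrt (<) ?vs" "\<forall>v\<in>set ?vs. 0 \<le> v"
          "build m 0 ?vs \<alpha> = P"
        using P build_starts[of 0 P m]
        by (auto simp: dyck_paths_comp_def dyck_paths_norths sorted_starts length_starts)
      have "list_all2 (\<le>) ?vs (bounds m n 0 \<alpha>)"
        using above_line_build[OF assms(1) vs(1,2) pos vs(3), of 0 m m] vs(4) P
        by (simp add: dyck_paths_comp_def dyck_paths_norths)
      then show "list_all2 (\<le>) (unshift 0 ?vs) (boundary m n \<alpha>)"
        by (simp add: list_all2_iff shift_unshift vs)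
      show "sorted (unshift 0 ?vs)"
        using vs(2) by (simp add: sorted_shift_iff[of 0, symmetric] shift_unshift)
    qed
  qed
qed

lemma run_ret_build:
  assumes "0 < n" "n < m" "composition n \<alpha>" "sorted ws" "list_all2 (\<le>) ws (boundary m n \<alpha>)"
  shows "run n (build m 0 (shift 0 ws) \<alpha>) = count_list ws 0"
    and "ret m n (build m 0 (shift 0 ws) \<alpha>) = contacts (boundary m n \<alpha>) ws"
proof -
  let ?vs = "shift 0 ws"
  have pos: "\<forall>a\<in>set \<alpha>. 0 < a" and sum: "sum_list \<alpha> = n"
    using assms by (simp_all add: composition_def)
  have len: "length ws = length \<alpha>"
    using list_all2_lengthD[OF assms(5)] by (simp add: boundary_def)
  have vs: "length ?vs = length \<alpha>" "sorted_wrt (<) ?vs" "\<forall>v\<in>set ?vs. 0 \<le> v"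
      "list_all2 (\<le>) ?vs (bounds m n 0 \<alpha>)"
    using assms len by (simp_all add: sorted_shift_iff boundary_def list_all2_shift_iff sorted_bounds pos)
  \<comment> \<open>As \<open>n > 0\<close> there is a first block; it starts at height 0, where the
    bound is 0, so \<open>ws\<close> begins with 0.\<close>
  obtain a as where "\<alpha> = a # as"
    using assms(1) sum by (cases \<alpha>) auto
  then have "hd ws = 0" "ws \<noteq> []"
    using assms(5) by (auto simp: boundary_def list_all2_Cons2)
  then show "run n (build m 0 ?vs \<alpha>) = count_list ws 0"
    using Min_missing_shift[OF assms(4), of n] length_le_sum_list[OF pos] sum len
      set_norths_build[OF vs(1,2) pos vs(3), of 0 m]
    by (simp add: run_def coarea_seq_norths)
  show "ret m n (build m 0 ?vs \<alpha>) = contacts (boundary m n \<alpha>) ws"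
    using ret_build[OF assms(1,2) vs(1,2) pos vs(3,4), of m]
    by (simp add: ret_norths boundary_def contacts_shift sorted_bounds assms(1,2) pos)
qed

lemma card_dyck_paths_run_ret:
  assumes "0 < n" "n < m" "composition n \<alpha>"
  shows "card (dyck_paths_run_ret m n \<alpha> k l) = card (below (boundary m n \<alpha>) k l)"
proof -
  let ?f = "\<lambda>ws. build m 0 (shift 0 ws) \<alpha>"
  note bij = bij_betw_build_dyck_paths_comp[OF assms]
  have "dyck_paths_run_ret m n \<alpha> k l = ?f ` below (boundary m n \<alpha>) k l"
    using run_ret_build[OF assms]
    by (auto simp: dyck_paths_run_ret_def below_def bij_betw_imp_surj_on[OF bij, symmetric])
  moreover have "inj_on ?f (below (boundary m n \<alpha>) k l)"
    using bij_betw_imp_inj_on[OF bij] by (rule inj_on_subset) (auto simp: below_def)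
  ultimately show ?thesis
    by (simp add: card_image)
qed

theorem theorem3p2:
  fixes m n a b :: nat and \<alpha> :: "nat list"
  assumes "0 < n" and "n < m"
    and "composition n \<alpha>"
    and "a \<le> b"
  shows "let r = rr n \<alpha> m in
    card (dyck_paths_run_ret m n \<alpha> (r + a) (r + b - a)) =
    card (dyck_paths_run_ret m n \<alpha> (r + b) r)"
proof -
  let ?r = "rr n \<alpha> m"
  obtain es where es: "boundary m n \<alpha> = replicate ?r 0 @ es" "0 \<notin> set es" "sorted es"
    using boundary_split[OF assms(1-3)] .
  \<comment> \<open>The forced prefix contributes \<open>?r\<close> to both statistics; stripping it
    leaves positive bounds, where contacts can be traded for zeros.\<close>
  have "card (dyck_paths_run_ret m n \<alpha> (?r + a) (?r + (b - a))) = card (below es a (0 + (b - a)))"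
    by (simp add: card_dyck_paths_run_ret[OF assms(1-3)] es card_below_replicate_zero)
  also have "\<dots> = card (below es b 0)"
    using card_below_add[OF es(3,2), of a 0 "b - a"] assms(4) by simp
  also have "\<dots> = card (dyck_paths_run_ret m n \<alpha> (?r + b) (?r + 0))"
    by (simp only: card_dyck_paths_run_ret[OF assms(1-3)] es card_below_replicate_zero)
  finally show ?thesis
    using assms(4) by (simp add: Let_def)
qed

end
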